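(* If $\vdash G\triangleright N$, $G$ is bounded and $G\parallel\mathcal M$ is weakly balanced, then the session $N\parallel\mathcal M$ is deadlock free.
   Context: Participants $\mathsf p,\mathsf q,\mathsf r,\mathsf s$; labels $\lambda$. Processes are the possibly infinite but regular terms coinductively generated by $P ::= \mathbf 0 \mid \mathsf p!\{\lambda_i;P_i\}_{i\in I}\mid \mathsf p?\{\lambda_i;P_i\}_{i\in I}$, $I$ finite nonempty, $\lambda_i$ pairwise distinct. A network is $N=\mathsf p_1[\![P_1]\!]\parallel\cdots\parallel\mathsf p_n[\![P_n]\!]$ with $n>0$ and pairwise distinct $\mathsf p_i$, taken modulo permutation and adding/removing components $\mathsf p[\![\mathbf 0]\!]$; $\mathrm{plays}(N)$ is the set of $\mathsf p$ with $N\equiv\mathsf p[\![P]\!]\parallel N'$, $P\neq\mathbf 0$. A message is $\langle\mathsf p,\lambda,\mathsf q\rangle$; a queue $\mathcal M$ is a finite sequence of messages ($\emptyset$, $\cdot$), modulo the congruence $\equiv$ generated by $\langle\mathsf p,\lambda,\mathsf q\rangle\cdot\langle\mathsf r,\lambda',\mathsf s\rangle\equiv\langle\mathsf r,\lambda',\mathsf s\rangle\cdot\langle\mathsf p,\lambda,\mathsf q\rangle$ when $\mathsf p\neq\mathsf r$ or $\mathsf q\neq\mathsf s$. Communications $\beta::=\mathsf p\mathsf q!\lambda\mid\mathsf p\mathsf q?\lambda$, $\mathrm{play}(\mathsf p\mathsf q!\lambda)=\mathsf p$, $\mathrm{play}(\mathsf p\mathsf q?\lambda)=\mathsf q$. Sessions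 $N\parallel\mathcal M$ reduce by: $\mathsf p[\![\mathsf q!\{\lambda_i;P_i\}_{i\in I}]\!]\parallel N\parallel\mathcal M\xrightarrow{\mathsf p\mathsf q!\lambda_h}\mathsf p[\![P_h]\!]\parallel N\parallel\mathcal M\cdot\langle\mathsf p,\lambda_h,\mathsf q\rangle$ and $\mathsf q[\![\mathsf p?\{\lambda_i;Q_i\}_{i\in I}]\!]\parallel N\parallel\langle\mathsf p,\lambda_h,\mathsf q\rangle\cdot\mathcal M\xrightarrow{\mathsf p\mathsf q?\lambda_h}\mathsf q[\![Q_h]\!]\parallel N\parallel\mathcal M$, $h\in I$. A nonempty set $\Delta$ of communications is coherent for a session $S$ if distinct elements of $\Delta$ have distinct players and $S$ has a $\beta$-transition for each $\beta\in\Delta$. $S\Rightarrow_\Delta S'$ if $\Delta=\{\beta_1,\ldots,\beta_n\}$ is a maximal coherent set for $S$ and $S\xrightarrow{\beta_1}\cdots\xrightarrow{\beta_n}S'$. A lockstep derivative of $S$ is any session reachable from $S$ by finitely many (possibly zero) such lockstep transitions. A session $N\parallel\mathcal M$ is terminated if $N\equiv\mathsf p[\![\mathbf 0]\!]$ and $\mathcal M=\emptyset$, deadlocked if it has no transition and is not terminated, and deadlock free if none of its lockstep derivatives is deadlocked. Global types: possibly infinite regular terms $G ::= \mathsf{End}\mid \mathsf p\mathsf q!\{\lambda_i;G_i\}_{i\in I}\mid\mathsf p\mathsf q?\{\lambda_i;G_i\}_{i\in I}$ ($I$ finite nonempty, $\mathsf p\neq\mathsf q$, $\lambda_i$ distinct);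 $\mathsf p\mathsf q\dagger$ denotes either form. $\mathrm{play}(\mathsf p\mathsf q!\{\ldots\})=\mathsf p$, $\mathrm{play}(\mathsf p\mathsf q?\{\ldots\})=\mathsf q$; $\mathrm{plays}(G)$ least set with $\mathrm{plays}(\mathsf{End})=\emptyset$, $\mathrm{plays}(G)=\{\mathrm{play}(G)\}\cup\bigcup_i\mathrm{plays}(G_i)$. Typing $\vdash G\triangleright N$ (coinductive): (End) $\vdash\mathsf{End}\triangleright\mathsf p[\![\mathbf 0]\!]$; (Out) if $\forall i\in I$: $\vdash G_i\triangleright\mathsf p[\![P_i]\!]\parallel N$ and $\mathrm{plays}(G_i)\setminus\{\mathsf p\}=\mathrm{plays}(N)$, then $\vdash\mathsf p\mathsf q!\{\lambda_i;G_i\}_{i\in I}\triangleright\mathsf p[\![\mathsf q!\{\lambda_i;P_i\}_{i\in I}]\!]\parallel N$; (In) if $I\subseteq J$ and $\forall i\in I$: $\vdash G_i\triangleright\mathsf p[\![P_i]\!]\parallel N$ and $\mathrm{plays}(G_i)\setminus\{\mathsf p\}=\mathrm{plays}(N)$, then $\vdash\mathsf q\mathsf p?\{\lambda_i;G_i\}_{i\in I}\triangleright\mathsf p[\![\mathsf q?\{\lambda_j;P_j\}_{j\in J}]\!]\parallel N$. Boundedness: $\mathrm{Paths}(G)$ is the greatest family with $\mathrm{Paths}(\mathsf{End})=\{\epsilon\}$ and $\mathrm{Paths}(\mathsf p\mathsf q\dagger\{\lambda_i;G_i\}_{i\in I})=\bigcup_{i}\{\mathsf p\mathsf q\dagger\lambda_i\cdot\xi\mid\xi\in\mathrm{Paths}(G_i)\}$;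 $\mathrm{depth}(\xi,\mathsf p)=\inf\{n\mid\mathrm{play}(\xi_n)=\mathsf p\}$ ($\inf\emptyset=\infty$); $\mathrm{depth}(G,\mathsf p)=1+\sup\{\mathrm{depth}(\xi,\mathsf p)\mid\xi\in\mathrm{Paths}(G)\}$ if $\mathsf p\in\mathrm{plays}(G)$, else $0$. $G$ is bounded if $\mathrm{depth}(G',\mathsf p)<\infty$ for all $G'$ occurring in $G$ and all $\mathsf p\in\mathrm{plays}(G')$. Weak balancing of $G\parallel\mathcal M$ (coinductive): $\mathsf{End}\parallel\emptyset$ is weakly balanced; $\mathsf p\mathsf q!\{\lambda_i;G_i\}_{i\in I}\parallel\mathcal M$ is if every $G_i\parallel\mathcal M\cdot\langle\mathsf p,\lambda_i,\mathsf q\rangle$ is; $\mathsf p\mathsf q?\{\lambda_i;G_i\}_{i\in I}\parallel\langle\mathsf p,\lambda_h,\mathsf q\rangle\cdot\mathcal M$ with $h\in I$ is if $G_h\parallel\mathcal M$ is. *)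

theory Defs
  imports Main "HOL-Library.Finite_Map" "HOL-Library.Extended_Nat"
begin

section \<open>Processes and networks\<close>

text \<open>
  A choice over a finite index set with pairwise distinct labels is a finite map from
  labels to continuations. Nonemptiness of choices and regularity of the (possibly infinite) terms
  are imposed by \<open>wf_proc\<close> and \<open>wf_gtype\<close>. In \<open>POut q Ps\<close> and \<open>PIn q Ps\<close>, the participant \<open>q\<close> is
  the partner.
\<close>

codatatype ('p, 'l) proc =
    PNil
  | POut 'p "('l, ('p, 'l) proc) fmap"
  | PIn 'p "('l, ('p, 'l) proc) fmap"

inductive psubterm :: "('p, 'l) proc \<Rightarrow> ('p, 'l) proc \<Rightarrow> bool" where
  psubterm_refl: "psubterm P P"
| psubterm_out: "fmlookup Ps l = Some P \<Longrightarrow> psubterm Q P \<Longrightarrow> psubterm Q (POut p Ps)"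
| psubterm_in: "fmlookup Ps l = Some P \<Longrightarrow> psubterm Q P \<Longrightarrow> psubterm Q (PIn p Ps)"

definition wf_proc :: "('p, 'l) proc \<Rightarrow> bool" where
  "wf_proc P \<longleftrightarrow> finite {Q. psubterm Q P} \<and>
     (\<forall>Q. psubterm Q P \<longrightarrow> (\<forall>p. Q \<noteq> POut p fmempty \<and> Q \<noteq> PIn p fmempty))"

text \<open>
  Networks are taken modulo permutation and addition or removal of components \<open>p[[0]]\<close>, so a network
  is a finitely supported map from participants to processes; \<open>p[[0]]\<close> is \<open>\<lambda>_. PNil\<close>, and a network
  of the form \<open>p[[P]] \<parallel> N\<close> is updated to \<open>p[[P']] \<parallel> N\<close> by function update at \<open>p\<close>.
\<close>

type_synonym ('p, 'l) network = "'p \<Rightarrow> ('p, 'l) proc"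

definition nplays :: "('p, 'l) network \<Rightarrow> 'p set" where
  "nplays N = {p. N p \<noteq> PNil}"

definition wf_network :: "('p, 'l) network \<Rightarrow> bool" where
  "wf_network N \<longleftrightarrow> finite (nplays N) \<and> (\<forall>p. wf_proc (N p))"

section \<open>Queues\<close>

text \<open>The message \<open>(p, l, q)\<close> has sender \<open>p\<close>, label \<open>l\<close> and receiver \<open>q\<close>.\<close>

type_synonym ('p, 'l) msg = "'p \<times> 'l \<times> 'p"

inductive qcong :: "('p, 'l) msg list \<Rightarrow> ('p, 'l) msg list \<Rightarrow> bool" where
  qcong_swap: "p \<noteq> r \<or> q \<noteq> s \<Longrightarrow> qcong [(p, l, q), (r, l', s)] [(r, l', s), (p, l, q)]"
| qcong_refl: "qcong xs xs"
| qcong_sym: "qcong xs ys \<Longrightarrow> qcong ys xs"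
| qcong_trans: "qcong xs ys \<Longrightarrow> qcong ys zs \<Longrightarrow> qcong xs zs"
| qcong_append: "qcong xs xs' \<Longrightarrow> qcong ys ys' \<Longrightarrow> qcong (xs @ ys) (xs' @ ys')"

quotient_type ('p, 'l) queue = "('p, 'l) msg list" / qcong
  by (intro equivpI reflpI sympI transpI) (blast intro: qcong_refl qcong_sym qcong_trans)+

lift_definition qempty :: "('p, 'l) queue" is "[]" .

lift_definition qmsg :: "'p \<Rightarrow> 'l \<Rightarrow> 'p \<Rightarrow> ('p, 'l) queue" is "\<lambda>p l q. [(p, l, q)]" .

lift_definition qappend :: "('p, 'l) queue \<Rightarrow> ('p, 'l) queue \<Rightarrow> ('p, 'l) queue" (infixr \<open>\<cdot>\<close> 65)
  is "(@)" by (rule qcong_append)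

section \<open>Sessions and lockstep reduction\<close>

text \<open>
  \<open>COut p q l\<close> is the output and \<open>CIn p q l\<close> the input of label \<open>l\<close> sent by \<open>p\<close> to \<open>q\<close>: the sender
  comes first in both.
\<close>

datatype ('p, 'l) comm = COut 'p 'p 'l | CIn 'p 'p 'l

fun cplay :: "('p, 'l) comm \<Rightarrow> 'p" where
  "cplay (COut p q l) = p"
| "cplay (CIn p q l) = q"

type_synonym ('p, 'l) session = "('p, 'l) network \<times> ('p, 'l) queue"

inductive step :: "('p, 'l) session \<Rightarrow> ('p, 'l) comm \<Rightarrow> ('p, 'l) session \<Rightarrow> bool" where
  step_send: "N p = POut q Ps \<Longrightarrow> fmlookup Ps l = Some P \<Longrightarrow>
    step (N, M) (COut p q l) (N(p := P), M \<cdot> qmsg p l q)"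
| step_receive: "N q = PIn p Qs \<Longrightarrow> fmlookup Qs l = Some Q \<Longrightarrow>
    step (N, qmsg p l q \<cdot> M) (CIn p q l) (N(q := Q), M)"

fun steps :: "('p, 'l) session \<Rightarrow> ('p, 'l) comm list \<Rightarrow> ('p, 'l) session \<Rightarrow> bool" where
  "steps S [] S' \<longleftrightarrow> S = S'"
| "steps S (\<beta> # \<beta>s) S' \<longleftrightarrow> (\<exists>S''. step S \<beta> S'' \<and> steps S'' \<beta>s S')"

definition coherent :: "('p, 'l) session \<Rightarrow> ('p, 'l) comm set \<Rightarrow> bool" where
  "coherent S \<Delta> \<longleftrightarrow> \<Delta> \<noteq> {} \<and>
     (\<forall>\<beta>\<in>\<Delta>. \<forall>\<beta>'\<in>\<Delta>. \<beta> \<noteq> \<beta>' \<longrightarrow> cplay \<beta> \<noteq> cplay \<beta>') \<and> (\<forall>\<beta>\<in>\<Delta>. \<exists>S'. step S \<beta> S')"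

definition max_coherent :: "('p, 'l) session \<Rightarrow> ('p, 'l) comm set \<Rightarrow> bool" where
  "max_coherent S \<Delta> \<longleftrightarrow> coherent S \<Delta> \<and> (\<forall>\<Delta>'. coherent S \<Delta>' \<and> \<Delta> \<subseteq> \<Delta>' \<longrightarrow> \<Delta>' = \<Delta>)"

definition lockstep :: "('p, 'l) session \<Rightarrow> ('p, 'l) comm set \<Rightarrow> ('p, 'l) session \<Rightarrow> bool" where
  "lockstep S \<Delta> S' \<longleftrightarrow>
     max_coherent S \<Delta> \<and> (\<exists>\<beta>s. distinct \<beta>s \<and> set \<beta>s = \<Delta> \<and> steps S \<beta>s S')"

definition lockstep_derivative :: "('p, 'l) session \<Rightarrow> ('p, 'l) session \<Rightarrow> bool" where
  "lockstep_derivative S S' \<longleftrightarrow> (\<lambda>S S'. \<exists>\<Delta>. lockstep S \<Delta> S')\<^sup>*\<^sup>* S S'"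

definition terminated :: "('p, 'l) session \<Rightarrow> bool" where
  "terminated S \<longleftrightarrow> S = (\<lambda>_. PNil, qempty)"

definition deadlocked :: "('p, 'l) session \<Rightarrow> bool" where
  "deadlocked S \<longleftrightarrow> (\<nexists>\<beta> S'. step S \<beta> S') \<and> \<not> terminated S"

definition deadlock_free :: "('p, 'l) session \<Rightarrow> bool" where
  "deadlock_free S \<longleftrightarrow> (\<forall>S'. lockstep_derivative S S' \<longrightarrow> \<not> deadlocked S')"

section \<open>Global types\<close>

text \<open>In both \<open>GOut p q Gs\<close> and \<open>GIn p q Gs\<close>, the sender is \<open>p\<close> and the receiver is \<open>q\<close>.\<close>

codatatype ('p, 'l) gtype =
    End
  | GOut 'p 'p "('l, ('p, 'l) gtype) fmap"
  | GIn 'p 'p "('l, ('p, 'l) gtype) fmap"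

inductive gsubterm :: "('p, 'l) gtype \<Rightarrow> ('p, 'l) gtype \<Rightarrow> bool" where
  gsubterm_refl: "gsubterm G G"
| gsubterm_out: "fmlookup Gs l = Some G \<Longrightarrow> gsubterm G' G \<Longrightarrow> gsubterm G' (GOut p q Gs)"
| gsubterm_in: "fmlookup Gs l = Some G \<Longrightarrow> gsubterm G' G \<Longrightarrow> gsubterm G' (GIn p q Gs)"

definition wf_gtype :: "('p, 'l) gtype \<Rightarrow> bool" where
  "wf_gtype G \<longleftrightarrow> finite {G'. gsubterm G' G} \<and>
     (\<forall>p q Gs. gsubterm (GOut p q Gs) G \<or> gsubterm (GIn p q Gs) G \<longrightarrow> p \<noteq> q \<and> Gs \<noteq> fmempty)"

inductive in_gplays :: "'p \<Rightarrow> ('p, 'l) gtype \<Rightarrow> bool" where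
  in_gplays_out: "in_gplays p (GOut p q Gs)"
| in_gplays_in: "in_gplays q (GIn p q Gs)"
| in_gplays_out_cont: "fmlookup Gs l = Some G \<Longrightarrow> in_gplays r G \<Longrightarrow> in_gplays r (GOut p q Gs)"
| in_gplays_in_cont: "fmlookup Gs l = Some G \<Longrightarrow> in_gplays r G \<Longrightarrow> in_gplays r (GIn p q Gs)"

definition gplays :: "('p, 'l) gtype \<Rightarrow> 'p set" where
  "gplays G = {p. in_gplays p G}"

section \<open>Typing\<close>

text \<open>
  The rules are stated for the whole network \<open>p[[_]] \<parallel> N\<close>, so the players of the remaining network
  are \<open>nplays N - {p}\<close>.
\<close>

coinductive typed :: "('p, 'l) gtype \<Rightarrow> ('p, 'l) network \<Rightarrow> bool" where
  typed_End: "typed End (\<lambda>_. PNil)"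
| typed_Out: "N p = POut q Ps \<Longrightarrow> fmdom Gs = fmdom Ps \<Longrightarrow>
    (\<forall>l G P. fmlookup Gs l = Some G \<longrightarrow> fmlookup Ps l = Some P \<longrightarrow>
       typed G (N(p := P)) \<and> gplays G - {p} = nplays N - {p}) \<Longrightarrow>
    typed (GOut p q Gs) N"
| typed_In: "N p = PIn q Ps \<Longrightarrow> fmdom Gs |\<subseteq>| fmdom Ps \<Longrightarrow>
    (\<forall>l G P. fmlookup Gs l = Some G \<longrightarrow> fmlookup Ps l = Some P \<longrightarrow>
       typed G (N(p := P)) \<and> gplays G - {p} = nplays N - {p}) \<Longrightarrow>
    typed (GIn q p Gs) N"

section \<open>Boundedness\<close>

text \<open>Paths are finite or infinite sequences of communications, indexed from 0.\<close>

codatatype 'a llist = LNil | LCons 'a "'a llist"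

primrec lnth_opt :: "nat \<Rightarrow> 'a llist \<Rightarrow> 'a option" where
  "lnth_opt 0 \<xi> = (case \<xi> of LNil \<Rightarrow> None | LCons x _ \<Rightarrow> Some x)"
| "lnth_opt (Suc n) \<xi> = (case \<xi> of LNil \<Rightarrow> None | LCons _ \<xi>' \<Rightarrow> lnth_opt n \<xi>')"

coinductive is_path :: "('p, 'l) gtype \<Rightarrow> ('p, 'l) comm llist \<Rightarrow> bool" where
  is_path_End: "is_path End LNil"
| is_path_out: "fmlookup Gs l = Some G \<Longrightarrow> is_path G \<xi> \<Longrightarrow>
    is_path (GOut p q Gs) (LCons (COut p q l) \<xi>)"
| is_path_in: "fmlookup Gs l = Some G \<Longrightarrow> is_path G \<xi> \<Longrightarrow>
    is_path (GIn p q Gs) (LCons (CIn p q l) \<xi>)"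

definition Paths :: "('p, 'l) gtype \<Rightarrow> ('p, 'l) comm llist set" where
  "Paths G = {\<xi>. is_path G \<xi>}"

definition path_depth :: "('p, 'l) comm llist \<Rightarrow> 'p \<Rightarrow> enat" where
  "path_depth \<xi> p = Inf {enat n | n. \<exists>\<beta>. lnth_opt n \<xi> = Some \<beta> \<and> cplay \<beta> = p}"

definition gdepth :: "('p, 'l) gtype \<Rightarrow> 'p \<Rightarrow> enat" where
  "gdepth G p = (if p \<in> gplays G then 1 + Sup {path_depth \<xi> p | \<xi>. \<xi> \<in> Paths G} else 0)"

definition gbounded :: "('p, 'l) gtype \<Rightarrow> bool" where
  "gbounded G \<longleftrightarrow> (\<forall>G' p. gsubterm G' G \<longrightarrow> p \<in> gplays G' \<longrightarrow> gdepth G' p < \<infinity>)"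

section \<open>Weak balancing\<close>

coinductive weakly_balanced :: "('p, 'l) gtype \<Rightarrow> ('p, 'l) queue \<Rightarrow> bool" where
  wb_End: "weakly_balanced End qempty"
| wb_Out: "(\<forall>l G. fmlookup Gs l = Some G \<longrightarrow> weakly_balanced G (M \<cdot> qmsg p l q)) \<Longrightarrow>
    weakly_balanced (GOut p q Gs) M"
| wb_In: "fmlookup Gs l = Some G \<Longrightarrow> weakly_balanced G M \<Longrightarrow>
    weakly_balanced (GIn p q Gs) (qmsg p l q \<cdot> M)"

end

(*
  Global types are only needed to start the argument. Call a session live if it is terminated or has
  players, and for each player r there is a scheduling of the other players, whatever labels they
  choose, which after finitely many steps enables r, in such a way that all steps of r lead to live
  sessions again. Typing and weak balancing provide the scheduling, boundedness makes it finite.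
  Steps of distinct players commute, so a step of r can be moved before the scheduled steps that
  precede it; hence liveness is preserved by arbitrary steps, and live sessions are not deadlocked.
*)

theory Submission imports Defs begin

section \<open>Queues as families of channels\<close>

text \<open>Queue congruence is a partial commutation: only messages of different channels may be
  swapped. The projections to the channels are therefore complete invariants.\<close>

definition chan_list :: "('p, 'l) msg list \<Rightarrow> 'p \<Rightarrow> 'p \<Rightarrow> 'l list" where
  "chan_list xs p q = map (fst \<circ> snd) (filter (\<lambda>m. fst m = p \<and> snd (snd m) = q) xs)"

lemma chan_list_simps [simp]:
  "chan_list [] p q = []"
  "chan_list ((p', l, q') # xs) p q =
     (if p' = p \<and> q' = q then l # chan_list xs p q else chan_list xs p q)"
  "chan_list (xs @ ys) p q = chan_list xs p q @ chan_list ys p q"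
  by (auto simp: chan_list_def)

lemma qcong_chan_list: "qcong xs ys \<Longrightarrow> chan_list xs = chan_list ys"
  by (induction rule: qcong.induct) (auto simp: fun_eq_iff)

lemma qcong_Cons: "qcong xs ys \<Longrightarrow> qcong (x # xs) (x # ys)"
  using qcong_append[of "[x]" "[x]" xs ys] qcong_refl by auto

text \<open>All messages before the first one from \<open>p\<close> to \<open>q\<close> lie on other
  channels, so it can be swapped to the front.\<close>

lemma chan_list_Cons_qcong:
  "chan_list xs p q = l # ls \<Longrightarrow> \<exists>ys. qcong xs ((p, l, q) # ys)"
proof (induction xs)
  case (Cons x xs)
  obtain p' l' q' where x: "x = (p', l', q')"
    by (cases x)
  show ?case
  proof (cases "p' = p \<and> q' = q")
    case True
    then show ?thesis
      using Cons.prems x qcong_refl by auto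
  next
    case False
    then obtain ys where "qcong xs ((p, l, q) # ys)"
      using Cons x by auto
    then have 1: "qcong (x # xs) (x # (p, l, q) # ys)"
      by (rule qcong_Cons)
    have "qcong ([x, (p, l, q)] @ ys) ([(p, l, q), x] @ ys)"
      using False x by (intro qcong_append qcong_refl) (auto intro: qcong_swap)
    then show ?thesis
      using 1 by (auto intro: qcong_trans)
  qed
qed simp

text \<open>The first message of \<open>xs\<close> heads its channel, so it can be moved to the
  front of \<open>ys\<close>; cancelling it leaves a shorter instance.\<close>

lemma chan_list_eq_qcong: "chan_list xs = chan_list ys \<Longrightarrow> qcong xs ys"
proof (induction xs arbitrary: ys)
  case Nil
  have "ys = []"
  proof (cases ys)
    case (Cons y ys')
    then show ?thesis
      using fun_cong[OF fun_cong[OF Nil, of "fst y"], of "snd (snd y)"] by (cases y) simp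
  qed simp
  then show ?case
    by (simp add: qcong_refl)
next
  case (Cons x xs)
  obtain p l q where x: "x = (p, l, q)"
    by (cases x)
  have "chan_list ys p q = l # chan_list xs p q"
    using fun_cong[OF fun_cong[OF Cons.prems, of p], of q] x by simp
  then obtain zs where zs: "qcong ys (x # zs)"
    using chan_list_Cons_qcong x by metis
  have "chan_list (x # xs) = chan_list (x # zs)"
    using Cons.prems qcong_chan_list[OF zs] by simp
  then have "chan_list xs = chan_list zs"
    by (auto simp: fun_eq_iff x split: if_splits)
  then have "qcong (x # xs) (x # zs)"
    by (intro qcong_Cons Cons.IH)
  then show ?case
    using zs qcong_sym qcong_trans by blast
qed

lift_definition chan :: "('p, 'l) queue \<Rightarrow> 'p \<Rightarrow> 'p \<Rightarrow> 'l list" is chan_list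
  by (rule qcong_chan_list)

lemma chan_simps [simp]:
  "chan qempty p q = []"
  "chan (qmsg p' l q') p q = (if p' = p \<and> q' = q then [l] else [])"
  "chan (M \<cdot> M') p q = chan M p q @ chan M' p q"
  by (transfer, simp)+

lemma queue_eqI: "(\<And>p q. chan M p q = chan M' p q) \<Longrightarrow> M = M'"
  by transfer (auto intro!: chan_list_eq_qcong)

lemma chan_Cons_qmsg: "chan M p q = l # ls \<Longrightarrow> \<exists>M'. M = qmsg p l q \<cdot> M'"
  by transfer (use chan_list_Cons_qcong in fastforce)

lemma qappend_assoc: "(M1 \<cdot> M2) \<cdot> M3 = M1 \<cdot> (M2 \<cdot> M3)"
  by (rule queue_eqI) simp

lemma qmsg_left_cancel:
  assumes "qmsg p l q \<cdot> M = qmsg p l' q \<cdot> M'"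
  shows "l = l'" and "M = M'"
proof -
  have eq: "chan (qmsg p l q \<cdot> M) a b = chan (qmsg p l' q \<cdot> M') a b" for a b
    by (simp only: assms)
  show "l = l'"
    using eq[of p q] by simp
  show "M = M'"
  proof (rule queue_eqI)
    show "chan M a b = chan M' a b" for a b
      using eq[of a b] by (simp split: if_splits)
  qed
qed

lemma qmsg_append_exchange: "p \<noteq> r \<or> q \<noteq> s \<Longrightarrow>
    (M \<cdot> qmsg p l q) \<cdot> qmsg r l' s = (M \<cdot> qmsg r l' s) \<cdot> qmsg p l q"
  by (rule queue_eqI) auto

text \<open>Removing a message from one channel leaves the heads of the others in place;
  \<open>K\<close> is the queue without both messages.\<close>

lemma qmsg_prepend_exchange:
  assumes eq: "qmsg p l q \<cdot> M = qmsg r l' s \<cdot> M'" and ne: "p \<noteq> r \<or> q \<noteq> s"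
  obtains K where "M = qmsg r l' s \<cdot> K" and "M' = qmsg p l q \<cdot> K"
proof -
  have ch: "chan (qmsg p l q \<cdot> M) a b = chan (qmsg r l' s \<cdot> M') a b" for a b
    by (simp only: eq)
  have "chan M r s = l' # chan M' r s"
    using ch[of r s] ne by auto
  then obtain K where K: "M = qmsg r l' s \<cdot> K"
    using chan_Cons_qmsg by metis
  have "M' = qmsg p l q \<cdot> K"
  proof (rule queue_eqI)
    show "chan M' a b = chan (qmsg p l q \<cdot> K) a b" for a b
      using ch[of a b] ne by (auto simp: K split: if_splits)
  qed
  with K show ?thesis
    by (rule that)
qed

section \<open>Commutation of steps\<close>

lemma step_determ: "step S \<beta> S1 \<Longrightarrow> step S \<beta> S2 \<Longrightarrow> S1 = S2"
  by (auto elim!: step.cases dest: qmsg_left_cancel)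

text \<open>Distinct players change distinct components. Two sends or two receives then use
  different channels, while a send and a receive act on opposite ends of the queue.\<close>

lemma step_diamond:
  assumes "step S \<beta> S1" and "step S \<gamma> S2" and "cplay \<beta> \<noteq> cplay \<gamma>"
  obtains T where "step S1 \<gamma> T" and "step S2 \<beta> T"
  using assms(1)
proof cases
  case s: (step_send N p q Ps l P M)
  show ?thesis
    using assms(2)
  proof cases
    case (step_send N' p' q' Ps' l' P' M')
    then have ne: "p \<noteq> p'" and [simp]: "N' = N" "M' = M"
      using s assms(3) by auto
    have "step S1 \<gamma> (N(p := P, p' := P'), (M \<cdot> qmsg p l q) \<cdot> qmsg p' l' q')"
      unfolding s step_send by (rule step.intros) (use s step_send ne in auto)
    moreover have "step S2 \<beta> (N(p' := P', p := P), (M \<cdot> qmsg p' l' q') \<cdot> qmsg p l q)"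
      unfolding s step_send by (simp, rule step.intros) (use s step_send ne in auto)
    ultimately show ?thesis
      using that ne by (simp add: fun_upd_twist qmsg_append_exchange)
  next
    case (step_receive N' q' p' Qs l' Q M')
    then have ne: "p \<noteq> q'" and [simp]: "N' = N" "M = qmsg p' l' q' \<cdot> M'"
      using s assms(3) by auto
    have "step S1 \<gamma> (N(p := P, q' := Q), M' \<cdot> qmsg p l q)"
      unfolding s step_receive \<open>M = _\<close> qappend_assoc
      by (rule step.intros) (use s step_receive ne in auto)
    moreover have "step S2 \<beta> (N(q' := Q, p := P), M' \<cdot> qmsg p l q)"
      unfolding s step_receive by (simp, rule step.intros) (use s step_receive ne in auto)
    ultimately show ?thesis
      using that ne by (simp add: fun_upd_twist)
  qed
next
  case r: (step_receive N q p Qs l Q M)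
  show ?thesis
    using assms(2)
  proof cases
    case (step_send N' p' q' Ps' l' P' M')
    then have ne: "q \<noteq> p'" and [simp]: "N' = N" "M' = qmsg p l q \<cdot> M"
      using r assms(3) by auto
    have "step S1 \<gamma> (N(q := Q, p' := P'), M \<cdot> qmsg p' l' q')"
      unfolding r step_send by (rule step.intros) (use r step_send ne in auto)
    moreover have "step S2 \<beta> (N(p' := P', q := Q), M \<cdot> qmsg p' l' q')"
      unfolding r step_send \<open>M' = _\<close> \<open>N' = _\<close> qappend_assoc
      by (rule step.intros) (use r step_send ne in auto)
    ultimately show ?thesis
      using that ne by (simp add: fun_upd_twist)
  next
    case (step_receive N' q' p' Qs' l' Q' M')
    then have ne: "q \<noteq> q'" and [simp]: "N' = N" and "qmsg p l q \<cdot> M = qmsg p' l' q' \<cdot> M'"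
      using r assms(3) by auto
    then obtain K where [simp]: "M = qmsg p' l' q' \<cdot> K" "M' = qmsg p l q \<cdot> K"
      using qmsg_prepend_exchange by metis
    have "step S1 \<gamma> (N(q := Q, q' := Q'), K)"
      unfolding r step_receive by (simp, rule step.intros) (use r step_receive ne in auto)
    moreover have "step S2 \<beta> (N(q' := Q', q := Q), K)"
      unfolding r step_receive by (simp, rule step.intros) (use r step_receive ne in auto)
    ultimately show ?thesis
      using that ne by (simp add: fun_upd_twist)
  qed
qed

lemma step_sendD: "step S (COut p q l) S' \<Longrightarrow> \<exists>Ps. fst S p = POut q Ps"
  by (auto elim!: step.cases)

lemma step_receiveD:
  "step S (CIn p q l) S' \<Longrightarrow> (\<exists>Qs. fst S q = PIn p Qs) \<and> (\<exists>ls. chan (snd S) p q = l # ls)"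
  by (auto elim!: step.cases)

text \<open>Only \<open>q\<close> removes messages addressed to \<open>q\<close>; other players at
  most append.\<close>

lemma step_chan_mono:
  assumes "step S \<beta> S'" and "cplay \<beta> \<noteq> q"
  shows "\<exists>ls. chan (snd S') p q = chan (snd S) p q @ ls"
  using assms by (auto elim!: step.cases)

lemma step_other_proc: "step S \<beta> S' \<Longrightarrow> cplay \<beta> \<noteq> q \<Longrightarrow> fst S' q = fst S q"
  by (auto elim!: step.cases)

lemma step_send_iff: "(\<exists>S'. step S (COut p q l) S') \<longleftrightarrow>
    (\<exists>Ps. fst S p = POut q Ps \<and> l |\<in>| fmdom Ps)"
  by (cases S) (force elim!: step.cases intro: step.intros simp: fmlookup_dom_iff)

lemma step_receive_iff: "(\<exists>S'. step S (CIn p q l) S') \<longleftrightarrow>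
    (\<exists>Qs ls. fst S q = PIn p Qs \<and> l |\<in>| fmdom Qs \<and> chan (snd S) p q = l # ls)"
  (is "?L \<longleftrightarrow> ?R")
proof
  show "?L \<Longrightarrow> ?R"
    by (auto elim!: step.cases simp: fmlookup_dom_iff)
  assume ?R
  then obtain Qs Q M' where "fst S q = PIn p Qs" "fmlookup Qs l = Some Q" "snd S = qmsg p l q \<cdot> M'"
    by (auto simp: fmlookup_dom_iff dest!: chan_Cons_qmsg)
  then show ?L
    by (cases S) (auto intro: step.intros)
qed

text \<open>
  A step may enable an input of its receiver, so it can only be postponed after the step \<open>\<gamma>\<close> of a
  player who could already move before: the message at the head of the channel is then the same.
\<close>

lemma step_reflect:
  assumes \<beta>: "step S \<beta> S'" and \<gamma>: "step S' \<gamma> T" and \<gamma>0: "step S \<gamma>0 U0"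
    and ne: "cplay \<gamma> \<noteq> cplay \<beta>" and play: "cplay \<gamma>0 = cplay \<gamma>"
  obtains U where "step S \<gamma> U" and "step U \<beta> T"
proof -
  have "\<exists>U. step S \<gamma> U"
  proof (cases \<gamma>)
    case (COut p q l)
    then show ?thesis
      using \<gamma> ne step_other_proc[OF \<beta>, of p] step_send_iff[of S' p q l] step_send_iff[of S p q l]
      by (metis cplay.simps(1))
  next
    case (CIn p q l)
    then obtain Qs ls where 1: "fst S q = PIn p Qs" "l |\<in>| fmdom Qs" "chan (snd S') p q = l # ls"
      using \<gamma> ne step_other_proc[OF \<beta>, of q] step_receive_iff[of S' p q l]
      by (metis cplay.simps(2))
    \<comment> \<open>The process of \<open>q\<close> is an input from \<open>p\<close> already in
      \<open>S\<close>, so its known move \<open>\<gamma>0\<close> reads the same channel.\<close>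
    obtain l0 where "\<gamma>0 = CIn p q l0"
      using play CIn 1(1) \<gamma>0 by (cases \<gamma>0) (auto dest: step_sendD step_receiveD)
    then obtain ls0 where "chan (snd S) p q = l0 # ls0"
      using \<gamma>0 step_receiveD by metis
    \<comment> \<open>The channel is nonempty in \<open>S\<close> and only grows at its end, so its
      head survives \<open>\<beta>\<close>.\<close>
    moreover have "l0 = l"
      using calculation step_chan_mono[OF \<beta>, of q p] ne CIn 1 by auto
    ultimately show ?thesis
      unfolding CIn step_receive_iff using 1 by simp
  qed
  then obtain U where U: "step S \<gamma> U" ..
  with \<beta> obtain T' where "step S' \<gamma> T'" "step U \<beta> T'"
    using ne by (metis step_diamond)
  with U \<gamma> show ?thesis
    using that step_determ by metis
qed

section \<open>Live sessions\<close>

definition enabled :: "'p \<Rightarrow> ('p, 'l) session \<Rightarrow> bool" where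
  "enabled p S \<longleftrightarrow> (\<exists>\<beta> S'. step S \<beta> S' \<and> cplay \<beta> = p)"

text \<open>The least fixed point makes every branch of the schedule finite, with one branch for
  each step of the scheduled player. The parameter \<open>X\<close> stays open so that a greatest
  fixed point can be taken around it.\<close>

inductive will_play :: "(('p, 'l) session \<Rightarrow> bool) \<Rightarrow> 'p \<Rightarrow> ('p, 'l) session \<Rightarrow> bool" for X r where
  will_play_now: "enabled r S \<Longrightarrow> (\<And>\<beta> S'. step S \<beta> S' \<Longrightarrow> cplay \<beta> = r \<Longrightarrow> X S') \<Longrightarrow>
    will_play X r S"
| will_play_later: "p \<noteq> r \<Longrightarrow> enabled p S \<Longrightarrow>
    (\<And>\<beta> S'. step S \<beta> S' \<Longrightarrow> cplay \<beta> = p \<Longrightarrow> will_play X r S') \<Longrightarrow> will_play X r S"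

lemma will_play_weaken:
  "will_play X r S \<Longrightarrow> (\<And>S. X S \<Longrightarrow> Y S) \<Longrightarrow> will_play Y r S"
  by (induction rule: will_play.induct) (blast intro: will_play.intros)+

text \<open>Required by the coinductive definition of \<open>live\<close>.\<close>

lemma will_play_mono [mono]: "X \<le> Y \<Longrightarrow> will_play X r S \<longrightarrow> will_play Y r S"
  by (auto intro: will_play_weaken)

text \<open>The first clause excludes messages left over after all processes have ended, which would
  be a deadlock.\<close>

coinductive live :: "('p, 'l) session \<Rightarrow> bool" where
  "(nplays (fst S) = {} \<Longrightarrow> snd S = qempty) \<Longrightarrow> (\<And>r. r \<in> nplays (fst S) \<Longrightarrow> will_play live r S) \<Longrightarrow>
    live S"

lemma enabled_nplays: "enabled p S \<Longrightarrow> p \<in> nplays (fst S)"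
  by (auto simp: enabled_def nplays_def elim!: step.cases)

text \<open>One unfolding of \<open>live\<close> at the target of a step, with \<open>Y\<close> as
  coinduction candidate. The induction follows the schedule that waits for the player of
  \<open>\<beta>\<close>: when that player is next, \<open>S'\<close> is live outright; before that,
  the scheduled step of \<open>p\<close> is swapped with \<open>\<beta>\<close>.\<close>

lemma will_play_step_disj:
  fixes S S' :: "('p, 'l) session"
  defines "Y \<equiv> \<lambda>T :: ('p, 'l) session.
    live T \<or> (\<exists>S \<beta>. will_play live (cplay \<beta>) S \<and> step S \<beta> T)"
  assumes "will_play live (cplay \<beta>) S" and "step S \<beta> S'"
  shows "(nplays (fst S') = {} \<longrightarrow> snd S' = qempty) \<and>
    (\<forall>s. s \<in> nplays (fst S') \<longrightarrow> will_play Y s S')"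
  using assms(2,3)
proof (induction arbitrary: S' rule: will_play.induct)
  case (will_play_now S)
  then have "live S'"
    by blast
  then show ?case
    by cases (auto simp: Y_def intro: will_play_weaken)
next
  case (will_play_later p S)
  from \<open>enabled p S\<close> obtain \<gamma>0 U0 where \<gamma>0: "step S \<gamma>0 U0" "cplay \<gamma>0 = p"
    by (auto simp: enabled_def)
  then have en: "enabled p S'"
    using step_diamond[OF will_play_later.prems, of \<gamma>0 U0] will_play_later.hyps(1)
    unfolding enabled_def by metis
  \<comment> \<open>The move \<open>\<gamma>0\<close> witnesses that \<open>p\<close> could act
    before \<open>\<beta>\<close>, as \<open>step_reflect\<close> demands.\<close>
  have refl: "\<exists>U. step S \<gamma> U \<and> step U \<beta> T" if "step S' \<gamma> T" "cplay \<gamma> = p" for \<gamma> T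
    using step_reflect[OF will_play_later.prems that(1) \<gamma>0(1)] that \<gamma>0(2) will_play_later.hyps(1)
    by metis
  have "will_play Y s S'" if s: "s \<in> nplays (fst S')" for s
  proof (cases "s = p")
    \<comment> \<open>A step of \<open>p\<close> leads to a session that \<open>\<beta>\<close>
      reaches from one whose schedule for the player of \<open>\<beta>\<close> goes on: the second
      disjunct of \<open>Y\<close>.\<close>
    case True
    then show ?thesis
      using en refl will_play_later.hyps(3) unfolding Y_def
      by (intro will_play.will_play_now) blast+
  next
    case False
    have "will_play Y s T" if T: "step S' \<gamma> T" "cplay \<gamma> = p" for \<gamma> T
    proof -
      obtain U where "step S \<gamma> U" "step U \<beta> T"
        using refl T by blast
      moreover have "s \<in> nplays (fst T)"
        using s step_other_proc[OF T(1), of s] T(2) False by (auto simp: nplays_def)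
      ultimately show ?thesis
        using will_play_later.IH T(2) by blast
    qed
    with en False show ?thesis
      using will_play.will_play_later[of p s S' Y] by blast
  qed
  \<comment> \<open>Since \<open>p\<close> is a player of \<open>S'\<close>, the clause on empty
    networks is vacuous.\<close>
  then show ?case
    using enabled_nplays[OF en] by blast
qed

text \<open>The coinduction asks of the source only a schedule for the player of
  \<open>\<beta>\<close>, because the intermediate sessions of a schedule are not yet known to be
  live.\<close>

lemma live_step:
  assumes "live S" and "step S \<beta> S'"
  shows "live S'"
proof -
  have "will_play live (cplay \<beta>) S"
    using assms enabled_nplays[of "cplay \<beta>" S] live.cases unfolding enabled_def by blast
  then have "\<exists>S \<beta>. will_play live (cplay \<beta>) S \<and> step S \<beta> S'"
    using assms by blast
  then show ?thesis
  proof (coinduction arbitrary: S' rule: live.coinduct)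
    case (live S')
    then obtain S \<beta> where "will_play live (cplay \<beta>) S" "step S \<beta> S'"
      by blast
    from will_play_step_disj[OF this] show ?case
      by (auto intro: will_play_weaken)
  qed
qed

section \<open>From single steps to lockstep derivatives and deadlock freedom\<close>

lemma live_steps: "steps S \<beta>s S' \<Longrightarrow> live S \<Longrightarrow> live S'"
  by (induction \<beta>s arbitrary: S) (auto intro: live_step)

lemma live_lockstep_derivative:
  assumes "lockstep_derivative S S'" and "live S"
  shows "live S'"
  using assms(1)[unfolded lockstep_derivative_def] assms(2)
  by (induction rule: rtranclp_induct) (auto simp: lockstep_def intro: live_steps)

text \<open>Without players, liveness empties the queue and the session is terminated; otherwise the
  schedule of any player starts with an enabled one.\<close>

lemma live_not_deadlocked:
  assumes "live S"
  shows "\<not> deadlocked S"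
proof (cases "nplays (fst S) = {}")
  case True
  with assms have "snd S = qempty"
    by (auto elim: live.cases)
  with True show ?thesis
    by (cases S) (auto simp: deadlocked_def terminated_def nplays_def)
next
  case False
  with assms obtain r where "will_play live r S"
    by (auto elim: live.cases)
  then show ?thesis
    by cases (auto simp: deadlocked_def enabled_def)
qed

lemma live_deadlock_free: "live S \<Longrightarrow> deadlock_free S"
  by (auto simp: deadlock_free_def dest: live_lockstep_derivative live_not_deadlocked)

section \<open>Paths and depth\<close>

text \<open>This guarantees that every type has a path, so that statements about all paths are not
  vacuous.\<close>

definition nonempty_choices :: "('p, 'l) gtype \<Rightarrow> bool" where
  "nonempty_choices G \<longleftrightarrow>
     (\<forall>p q. \<not> gsubterm (GOut p q fmempty) G \<and> \<not> gsubterm (GIn p q fmempty) G)"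

lemma wf_gtype_nonempty_choices: "wf_gtype G \<Longrightarrow> nonempty_choices G"
  unfolding wf_gtype_def nonempty_choices_def by blast

lemma nonempty_choices_cont:
  assumes "nonempty_choices G" and "G = GOut p q Gs \<or> G = GIn p q Gs"
  shows "Gs \<noteq> fmempty" and "fmlookup Gs l = Some G' \<Longrightarrow> nonempty_choices G'"
  using assms unfolding nonempty_choices_def by (blast intro: gsubterm.intros)+

lemma fmap_nonempty_lookup: "m \<noteq> fmempty \<Longrightarrow> \<exists>l x. fmlookup m l = Some x"
  by (metis fmap_ext fmempty_lookup not_None_eq)

primcorec some_path :: "('p, 'l) gtype \<Rightarrow> ('p, 'l) comm llist" where
  "some_path G = (case G of
      End \<Rightarrow> LNil
    | GOut p q Gs \<Rightarrow> LCons (COut p q (SOME l. l |\<in>| fmdom Gs))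
        (some_path (the (fmlookup Gs (SOME l. l |\<in>| fmdom Gs))))
    | GIn p q Gs \<Rightarrow> LCons (CIn p q (SOME l. l |\<in>| fmdom Gs))
        (some_path (the (fmlookup Gs (SOME l. l |\<in>| fmdom Gs)))))"

lemma some_path_simps:
  "some_path End = LNil"
  "some_path (GOut p q Gs) = LCons (COut p q (SOME l. l |\<in>| fmdom Gs))
     (some_path (the (fmlookup Gs (SOME l. l |\<in>| fmdom Gs))))"
  "some_path (GIn p q Gs) = LCons (CIn p q (SOME l. l |\<in>| fmdom Gs))
     (some_path (the (fmlookup Gs (SOME l. l |\<in>| fmdom Gs))))"
  by (subst some_path.code, simp)+

text \<open>Choices are nonempty, so \<open>SOME\<close> selects an actual label at each node;
  continuations inherit the hypothesis, which serves as coinduction invariant.\<close>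

lemma is_path_some_path:
  assumes "nonempty_choices G"
  shows "is_path G (some_path G)"
proof -
  have some: "\<exists>G'. fmlookup Gs (SOME l. l |\<in>| fmdom Gs) = Some G'"
    if "Gs \<noteq> fmempty" for Gs :: "('l, ('p, 'l) gtype) fmap"
    using fmap_nonempty_lookup[OF that] someI_ex[of "\<lambda>l. l |\<in>| fmdom Gs"]
    by (auto simp: fmlookup_dom_iff)
  from assms show ?thesis
  proof (coinduction arbitrary: G rule: is_path.coinduct)
    case ne: (is_path G)
    show ?case
    proof (cases G)
      case End
      then show ?thesis
        by (simp add: some_path_simps(1))
    next
      case (GOut p q Gs)
      moreover obtain G' where "fmlookup Gs (SOME l. l |\<in>| fmdom Gs) = Some G'"
        using some nonempty_choices_cont(1)[OF ne] GOut by blast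
      ultimately show ?thesis
        using nonempty_choices_cont(2)[OF ne, of p q Gs] by (auto simp: some_path_simps)
    next
      case (GIn p q Gs)
      moreover obtain G' where "fmlookup Gs (SOME l. l |\<in>| fmdom Gs) = Some G'"
        using some nonempty_choices_cont(1)[OF ne] GIn by blast
      ultimately show ?thesis
        using nonempty_choices_cont(2)[OF ne, of p q Gs] by (auto simp: some_path_simps)
    qed
  qed
qed

text \<open>A depth bound in natural numbers. It is strict, so \<open>n = 0\<close> contradicts the
  existence of a path.\<close>

definition plays_within :: "nat \<Rightarrow> ('p, 'l) gtype \<Rightarrow> 'p \<Rightarrow> bool" where
  "plays_within n G r \<longleftrightarrow>
     (\<forall>\<xi>. is_path G \<xi> \<longrightarrow> (\<exists>k<n. \<exists>\<beta>. lnth_opt k \<xi> = Some \<beta> \<and> cplay \<beta> = r))"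

lemma gdepth_plays_within:
  assumes "r \<in> gplays G" and "gdepth G r < \<infinity>"
  shows "\<exists>n. plays_within n G r"
proof -
  have "Sup {path_depth \<xi> r | \<xi>. \<xi> \<in> Paths G} \<noteq> \<infinity>"
    using assms by (intro notI) (simp add: gdepth_def)
  then obtain n where n: "Sup {path_depth \<xi> r | \<xi>. \<xi> \<in> Paths G} = enat n"
    by auto
  \<comment> \<open>The supremum \<open>n\<close> bounds positions inclusively, hence the strict
    bound \<open>Suc n\<close>.\<close>
  have "\<exists>k<Suc n. \<exists>\<beta>. lnth_opt k \<xi> = Some \<beta> \<and> cplay \<beta> = r" if "is_path G \<xi>" for \<xi>
  proof -
    have "path_depth \<xi> r \<le> enat n"
      unfolding n[symmetric] using that by (intro Sup_upper) (auto simp: Paths_def)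
    then have "path_depth \<xi> r < enat (Suc n)"
      by (auto intro: le_less_trans)
    then show ?thesis
      unfolding path_depth_def Inf_less_iff by auto
  qed
  then show ?thesis
    unfolding plays_within_def by blast
qed

text \<open>Prefixing the root communication to a path of \<open>G'\<close> gives a path of
  \<open>G\<close>. The root is not played by \<open>r\<close>, so the position found is positive
  and drops by one.\<close>

lemma plays_within_cont:
  assumes "plays_within (Suc n) G r"
    and "G = GOut p q Gs \<and> p \<noteq> r \<or> G = GIn p q Gs \<and> q \<noteq> r" and "fmlookup Gs l = Some G'"
  shows "plays_within n G' r"
  unfolding plays_within_def
proof (intro allI impI)
  fix \<xi> assume \<xi>: "is_path G' \<xi>"
  obtain \<beta> where "is_path G (LCons \<beta> \<xi>)" and \<beta>: "cplay \<beta> \<noteq> r"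
    using assms(2,3) \<xi> by (metis cplay.simps is_path_in is_path_out)
  then obtain k \<gamma> where "k < Suc n" "lnth_opt k (LCons \<beta> \<xi>) = Some \<gamma>" "cplay \<gamma> = r"
    using assms(1) unfolding plays_within_def by blast
  with \<beta> show "\<exists>k<n. \<exists>\<beta>. lnth_opt k \<xi> = Some \<beta> \<and> cplay \<beta> = r"
    by (cases k) auto
qed

section \<open>Typable sessions are live\<close>

lemma gbounded_cont:
  assumes "gbounded G" and "G = GOut p q Gs \<or> G = GIn p q Gs" and "fmlookup Gs l = Some G'"
  shows "gbounded G'"
  using assms unfolding gbounded_def by (blast intro: gsubterm.intros)

lemma gplays_GOut: "gplays (GOut p q Gs) = insert p (\<Union>l. \<Union>G\<in>set_option (fmlookup Gs l). gplays G)"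
  by (auto simp: gplays_def intro: in_gplays.intros elim: in_gplays.cases)

lemma gplays_GIn: "gplays (GIn p q Gs) = insert q (\<Union>l. \<Union>G\<in>set_option (fmlookup Gs l). gplays G)"
  by (auto simp: gplays_def intro: in_gplays.intros elim: in_gplays.cases)

lemma gplays_End: "gplays End = {}"
  by (auto simp: gplays_def elim: in_gplays.cases)

text \<open>The side conditions of typing give equality apart from the root player, who belongs to
  both sides.\<close>

lemma typed_gplays:
  assumes "typed G N" and "nonempty_choices G"
  shows "gplays G = nplays N"
  using assms(1)
proof cases
  case typed_End
  then show ?thesis
    by (simp add: gplays_End nplays_def)
next
  case (typed_Out p q Ps Gs)
  \<comment> \<open>An actual branch yields the inclusion of \<open>nplays N\<close> in
    \<open>gplays G\<close>.\<close>
  obtain l0 G0 where l0: "fmlookup Gs l0 = Some G0"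
    using fmap_nonempty_lookup nonempty_choices_cont(1)[OF assms(2)] typed_Out(1) by metis
  have eq: "gplays G' - {p} = nplays N - {p}" if "fmlookup Gs l = Some G'" for l G'
    using typed_Out(3,4) that by (metis fmdomE fmdomI)
  have "p \<in> nplays N"
    using typed_Out by (simp add: nplays_def)
  then show ?thesis
    using eq l0 unfolding typed_Out(1) gplays_GOut by fastforce
next
  case (typed_In p q Ps Gs)
  obtain l0 G0 where l0: "fmlookup Gs l0 = Some G0"
    using fmap_nonempty_lookup nonempty_choices_cont(1)[OF assms(2)] typed_In(1) by metis
  have eq: "gplays G' - {p} = nplays N - {p}" if "fmlookup Gs l = Some G'" for l G'
    using typed_In(3,4) that by (metis fmdomE fmdomI fsubsetD)
  have "p \<in> nplays N"
    using typed_In by (simp add: nplays_def)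
  then show ?thesis
    using eq l0 unfolding typed_In(1) gplays_GIn by fastforce
qed

text \<open>These conditions pass to a branch of the type whenever its root player moves.\<close>

definition typable :: "('p, 'l) gtype \<Rightarrow> ('p, 'l) session \<Rightarrow> bool" where
  "typable G S \<longleftrightarrow>
     nonempty_choices G \<and> gbounded G \<and> typed G (fst S) \<and> weakly_balanced G (snd S)"

lemma typable_End:
  assumes "typable End S"
  shows "nplays (fst S) = {}" and "snd S = qempty"
  using assms by (auto simp: typable_def nplays_def elim: typed.cases weakly_balanced.cases)

text \<open>The process of \<open>p\<close> offers exactly the labels of \<open>Gs\<close>, so the
  type has a branch for whichever label is sent.\<close>

lemma typable_GOut:
  assumes "typable (GOut p q Gs) S"
  shows "enabled p S"
    and "step S \<beta> S' \<Longrightarrow> cplay \<beta> = p \<Longrightarrow> \<exists>l G. fmlookup Gs l = Some G \<and> typable G S'"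
proof -
  obtain N M where S: "S = (N, M)"
    by (cases S)
  have ne: "nonempty_choices (GOut p q Gs)" and bd: "gbounded (GOut p q Gs)"
    and ty: "typed (GOut p q Gs) N" and wb: "weakly_balanced (GOut p q Gs) M"
    using assms by (auto simp: typable_def S)
  obtain Ps where N: "N p = POut q Ps" and dom: "fmdom Gs = fmdom Ps"
    and cont: "\<And>l G P. fmlookup Gs l = Some G \<Longrightarrow> fmlookup Ps l = Some P \<Longrightarrow> typed G (N(p := P))"
    using ty by cases auto
  have wb': "weakly_balanced G (M \<cdot> qmsg p l q)" if "fmlookup Gs l = Some G" for l G
    using wb that by cases auto
  obtain l G where "fmlookup Gs l = Some G"
    using fmap_nonempty_lookup nonempty_choices_cont(1)[OF ne] by blast
  then obtain P where "fmlookup Ps l = Some P"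
    using dom by (metis fmdomE fmdomI)
  then have "step S (COut p q l) (N(p := P), M \<cdot> qmsg p l q)"
    unfolding S using N by (intro step.intros)
  then show "enabled p S"
    unfolding enabled_def by force
  assume st: "step S \<beta> S'" "cplay \<beta> = p"
  from st(1) show "\<exists>l G. fmlookup Gs l = Some G \<and> typable G S'"
  proof cases
    case (step_send N' p' q' Ps' l P M')
    then have [simp]: "N' = N" "p' = p" "Ps' = Ps" "q' = q" "M' = M"
      using st(2) N S by auto
    obtain G where "fmlookup Gs l = Some G"
      using step_send dom by (metis \<open>Ps' = Ps\<close> fmdomE fmdomI)
    then have "typable G S'"
      using step_send cont wb' nonempty_choices_cont(2)[OF ne] gbounded_cont[OF bd]
      by (auto simp: typable_def)
    with \<open>fmlookup Gs l = Some G\<close> show ?thesis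
      by blast
  next
    case step_receive
    then show ?thesis
      using st(2) N S by auto
  qed
qed

text \<open>The process may accept more labels than \<open>Gs\<close> has, but weak balancing puts a
  label of \<open>Gs\<close> at the head of the channel, and a receive by \<open>q\<close> must take
  it.\<close>

lemma typable_GIn:
  assumes "typable (GIn p q Gs) S"
  shows "enabled q S"
    and "step S \<beta> S' \<Longrightarrow> cplay \<beta> = q \<Longrightarrow> \<exists>l G. fmlookup Gs l = Some G \<and> typable G S'"
proof -
  obtain N M where S: "S = (N, M)"
    by (cases S)
  have ne: "nonempty_choices (GIn p q Gs)" and bd: "gbounded (GIn p q Gs)"
    and ty: "typed (GIn p q Gs) N" and wb: "weakly_balanced (GIn p q Gs) M"
    using assms by (auto simp: typable_def S)
  obtain Ps where N: "N q = PIn p Ps" and dom: "fmdom Gs |\<subseteq>| fmdom Ps"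
    and cont: "\<And>l G P. fmlookup Gs l = Some G \<Longrightarrow> fmlookup Ps l = Some P \<Longrightarrow> typed G (N(q := P))"
    using ty by cases auto
  obtain l G M0 where G: "fmlookup Gs l = Some G" "weakly_balanced G M0" and M: "M = qmsg p l q \<cdot> M0"
    using wb by cases auto
  then obtain P where P: "fmlookup Ps l = Some P"
    using dom by (metis fmdomE fmdomI fsubsetD)
  have "step S (CIn p q l) (N(q := P), M0)"
    unfolding S M using N P by (intro step.intros)
  then show "enabled q S"
    unfolding enabled_def by force
  assume st: "step S \<beta> S'" "cplay \<beta> = q"
  from st(1) show "\<exists>l G. fmlookup Gs l = Some G \<and> typable G S'"
  proof cases
    case step_send
    then show ?thesis
      using st(2) N S by auto
  next
    case (step_receive N' q' p' Qs l' Q M')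
    then have [simp]: "N' = N" "q' = q" "Qs = Ps" "p' = p" and "qmsg p l q \<cdot> M0 = qmsg p l' q \<cdot> M'"
      using st(2) N S M by auto
    then have [simp]: "l' = l" "M' = M0"
      by (auto dest: qmsg_left_cancel)
    have "typable G S'"
      using step_receive cont G P nonempty_choices_cont(2)[OF ne] gbounded_cont[OF bd]
      by (auto simp: typable_def)
    with G(1) show ?thesis
      by blast
  qed
qed

text \<open>The type is the scheduler: its root player moves, each move leads into a branch, and the
  bound \<open>n\<close> drops until \<open>r\<close> is at the root.\<close>

lemma typable_will_play:
  assumes "typable G S" and "r \<in> nplays (fst S)" and "plays_within n G r"
  shows "will_play (\<lambda>S. \<exists>G. typable G S) r S"
  using assms
proof (induction n arbitrary: G S)
  case 0
  \<comment> \<open>Bound 0 rules out any path, yet one exists.\<close>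
  have "is_path G (some_path G)"
    using 0 by (simp add: typable_def is_path_some_path)
  then show ?case
    using 0 by (auto simp: plays_within_def)
next
  case (Suc n)
  have later: "will_play (\<lambda>S. \<exists>G. typable G S) r S"
    if "p \<noteq> r" "enabled p S"
      "\<And>\<beta> S'. step S \<beta> S' \<Longrightarrow> cplay \<beta> = p \<Longrightarrow> \<exists>G. plays_within n G r \<and> typable G S'" for p
  proof (rule will_play.will_play_later[OF that(1,2)])
    fix \<beta> S' assume st: "step S \<beta> S'" "cplay \<beta> = p"
    then have "r \<in> nplays (fst S')"
      using Suc.prems(2) step_other_proc[OF st(1), of r] that(1) by (auto simp: nplays_def)
    then show "will_play (\<lambda>S. \<exists>G. typable G S) r S'"
      using Suc.IH that(3)[OF st] by blast
  qed
  show ?case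
  proof (cases G)
    case End
    then show ?thesis
      using Suc.prems typable_End by blast
  next
    case (GOut p q Gs)
    note ty = typable_GOut[OF Suc.prems(1)[unfolded GOut]]
    show ?thesis
    proof (cases "p = r")
      case True
      then show ?thesis
        using ty by (intro will_play.will_play_now) blast+
    next
      case False
      then show ?thesis
        using ty plays_within_cont[OF Suc.prems(3), of p q Gs] GOut by (intro later[of p]) blast+
    qed
  next
    case (GIn p q Gs)
    note ty = typable_GIn[OF Suc.prems(1)[unfolded GIn]]
    show ?thesis
    proof (cases "q = r")
      case True
      then show ?thesis
        using ty by (intro will_play.will_play_now) blast+
    next
      case False
      then show ?thesis
        using ty plays_within_cont[OF Suc.prems(3), of p q Gs] GIn by (intro later[of q]) blast+
    qed
  qed
qed

text \<open>Typability by some type is the coinduction invariant; boundedness gives each player a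
  finite schedule.\<close>

lemma typable_live:
  assumes "typable G S"
  shows "live S"
proof -
  have "\<exists>G. typable G S"
    using assms by blast
  then show ?thesis
  proof (coinduction arbitrary: S rule: live.coinduct)
    case (live S)
    then obtain G where G: "typable G S"
      by blast
    then have eq: "gplays G = nplays (fst S)"
      by (simp add: typable_def typed_gplays)
    \<comment> \<open>A type other than \<open>End\<close> has its root player among the players of
      the network.\<close>
    have "snd S = qempty" if "nplays (fst S) = {}"
    proof (cases G)
      case End
      then show ?thesis
        using G typable_End by blast
    qed (use eq that in \<open>auto simp: gplays_GOut gplays_GIn\<close>)
    moreover have "will_play (\<lambda>S. \<exists>G. typable G S) r S" if r: "r \<in> nplays (fst S)" for r
    proof -
      have "gdepth G r < \<infinity>"
        using G r eq gsubterm_refl unfolding typable_def gbounded_def by blast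
      then obtain n where "plays_within n G r"
        using gdepth_plays_within[of r G] r[folded eq] by blast
      then show ?thesis
        by (rule typable_will_play[OF G r])
    qed
    ultimately show ?case
      by (auto intro: will_play_weaken)
  qed
qed

theorem theorem4p8:
  fixes G :: "('p, 'l) gtype" and N :: "('p, 'l) network" and M :: "('p, 'l) queue"
  assumes "wf_gtype G" and "wf_network N"
    and "typed G N" and "gbounded G" and "weakly_balanced G M"
  shows "deadlock_free (N, M)"
proof -
  have "typable G (N, M)"
    using assms by (simp add: typable_def wf_gtype_nonempty_choices)
  then show ?thesis
    by (intro live_deadlock_free typable_live)
qed

end
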